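(* Let $M$ be a non-zero left $R$-module which is an S-IAD-module and assume that every $R$-submodule of $M$ that is fully coprime in $M$ is simple. Then $M$ is colocal if and only if $\mathrm{Spec}^{\mathrm{fc}}(M)$ is connected.
   Context: $R$ is an associative (not necessarily commutative) ring with $1_R\neq 0_R$ and modules are unital left $R$-modules; $L\leq_R M$ means that $L$ is an $R$-submodule of $M$. A submodule $L\leq_R M$ is fully invariant if $f(L)\subseteq L$ for every $R$-linear endomorphism $f$ of $M$; $M$ is duo if every $R$-submodule of $M$ is fully invariant. $M$ is self-injective if for every $N\leq_R M$ every $R$-linear map $N\to M$ extends to an endomorphism of $M$. $M$ is atomic if every non-zero submodule of $M$ contains a simple submodule. An S-IAD-module is a module that is self-injective, atomic and duo. $M$ is colocal if it has a smallest non-zero submodule (one contained in every non-zero submodule), equivalently $\bigcap_{0\neq L\leq_R M}L\neq 0$. For $X,Y\leq_R M$ put $\mathrm{An}(X)=\{f\in \mathrm{End}_R(M)\mid f(X)=0\}$ and $X\odot_M Y=\bigcap_{f\in\mathrm{An}(X)} f^{-1}(Y)$. A non-zero fully invariant submodule $K$ of $M$ is fully coprime in $M$ if for all fully invariant submodules $X,Y$ of $M$: $K\subseteq X\odot_M Y$ implies $K\subseteq X$ or $K\subseteq Y$. $\mathrm{Spec}^{\mathrm{fc}}(M)$ is the set of all non-zero fully invariant submodules of $M$ that are fully coprime in $M$. For $M$ duo, $\mathrm{Spec}^{\mathrm{fc}}(M)$ carries the topology whose closed sets are $\mathcal{V}^{\mathrm{fc}}(L)=\{K\in\mathrm{Spec}^{\mathrm{fc}}(M)\mid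 K\subseteq L\}$, $L\leq_R M$. A topological space is connected if it is non-empty and its only clopen subsets are $\varnothing$ and the whole space. *)

theory Defs
  imports "HOL-Algebra.Module" "HOL-Analysis.Abstract_Topology"
begin

(* The locale module of HOL-Algebra requires a commutative ring of scalars. The following has the
   same axioms over an arbitrary ring; the record type module and the predicate submodule of
   HOL-Algebra do not depend on commutativity and are reused. *)
locale left_module = R?: ring R + M?: abelian_group M
  for R :: "('a, 'm) ring_scheme" (structure) and M :: "('a, 'b, 'n) module_scheme" (structure) +
  assumes smult_closed [simp, intro]:
      "\<lbrakk>a \<in> carrier R; x \<in> carrier M\<rbrakk> \<Longrightarrow> a \<odot>\<^bsub>M\<^esub> x \<in> carrier M"
    and smult_l_distr:
      "\<lbrakk>a \<in> carrier R; b \<in> carrier R; x \<in> carrier M\<rbrakk> \<Longrightarrow>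
        (a \<oplus>\<^bsub>R\<^esub> b) \<odot>\<^bsub>M\<^esub> x = a \<odot>\<^bsub>M\<^esub> x \<oplus>\<^bsub>M\<^esub> b \<odot>\<^bsub>M\<^esub> x"
    and smult_r_distr:
      "\<lbrakk>a \<in> carrier R; x \<in> carrier M; y \<in> carrier M\<rbrakk> \<Longrightarrow>
        a \<odot>\<^bsub>M\<^esub> (x \<oplus>\<^bsub>M\<^esub> y) = a \<odot>\<^bsub>M\<^esub> x \<oplus>\<^bsub>M\<^esub> a \<odot>\<^bsub>M\<^esub> y"
    and smult_assoc1:
      "\<lbrakk>a \<in> carrier R; b \<in> carrier R; x \<in> carrier M\<rbrakk> \<Longrightarrow>
        (a \<otimes>\<^bsub>R\<^esub> b) \<odot>\<^bsub>M\<^esub> x = a \<odot>\<^bsub>M\<^esub> (b \<odot>\<^bsub>M\<^esub> x)"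
    and smult_one [simp]:
      "x \<in> carrier M \<Longrightarrow> \<one>\<^bsub>R\<^esub> \<odot>\<^bsub>M\<^esub> x = x"

definition module_homs ::
    "('a, 'm) ring_scheme \<Rightarrow> ('a, 'b, 'n) module_scheme \<Rightarrow> ('a, 'c, 'p) module_scheme \<Rightarrow> ('b \<Rightarrow> 'c) set"
  where "module_homs R M N = {f \<in> carrier M \<rightarrow> carrier N.
    (\<forall>x\<in>carrier M. \<forall>y\<in>carrier M. f (x \<oplus>\<^bsub>M\<^esub> y) = f x \<oplus>\<^bsub>N\<^esub> f y) \<and>
    (\<forall>a\<in>carrier R. \<forall>x\<in>carrier M. f (a \<odot>\<^bsub>M\<^esub> x) = a \<odot>\<^bsub>N\<^esub> f x)}"

abbreviation module_endos :: "('a, 'm) ring_scheme \<Rightarrow> ('a, 'b, 'n) module_scheme \<Rightarrow> ('b \<Rightarrow> 'b) set"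
  where "module_endos R M \<equiv> module_homs R M M"

definition fully_invariant ::
    "('a, 'm) ring_scheme \<Rightarrow> ('a, 'b, 'n) module_scheme \<Rightarrow> 'b set \<Rightarrow> bool"
  where "fully_invariant R M L \<longleftrightarrow> submodule L R M \<and> (\<forall>f\<in>module_endos R M. f ` L \<subseteq> L)"

definition duo_module :: "('a, 'm) ring_scheme \<Rightarrow> ('a, 'b, 'n) module_scheme \<Rightarrow> bool"
  where "duo_module R M \<longleftrightarrow> (\<forall>L. submodule L R M \<longrightarrow> fully_invariant R M L)"

definition self_injective :: "('a, 'm) ring_scheme \<Rightarrow> ('a, 'b, 'n) module_scheme \<Rightarrow> bool"
  where "self_injective R M \<longleftrightarrow>
    (\<forall>N. submodule N R M \<longrightarrow>
      (\<forall>g\<in>module_homs R (M\<lparr>carrier := N\<rparr>) M. \<exists>h\<in>module_endos R M. \<forall>x\<in>N. h x = g x))"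

definition simple_module :: "('a, 'm) ring_scheme \<Rightarrow> ('a, 'b, 'n) module_scheme \<Rightarrow> bool"
  where "simple_module R N \<longleftrightarrow>
    carrier N \<noteq> {\<zero>\<^bsub>N\<^esub>} \<and> (\<forall>L. submodule L R N \<longrightarrow> L = {\<zero>\<^bsub>N\<^esub>} \<or> L = carrier N)"

definition simple_submodule ::
    "('a, 'm) ring_scheme \<Rightarrow> ('a, 'b, 'n) module_scheme \<Rightarrow> 'b set \<Rightarrow> bool"
  where "simple_submodule R M S \<longleftrightarrow> submodule S R M \<and> simple_module R (M\<lparr>carrier := S\<rparr>)"

definition atomic_module :: "('a, 'm) ring_scheme \<Rightarrow> ('a, 'b, 'n) module_scheme \<Rightarrow> bool"
  where "atomic_module R M \<longleftrightarrow>
    (\<forall>L. submodule L R M \<and> L \<noteq> {\<zero>\<^bsub>M\<^esub>} \<longrightarrow> (\<exists>S. simple_submodule R M S \<and> S \<subseteq> L))"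

definition S_IAD_module :: "('a, 'm) ring_scheme \<Rightarrow> ('a, 'b, 'n) module_scheme \<Rightarrow> bool"
  where "S_IAD_module R M \<longleftrightarrow> self_injective R M \<and> atomic_module R M \<and> duo_module R M"

definition colocal_module :: "('a, 'm) ring_scheme \<Rightarrow> ('a, 'b, 'n) module_scheme \<Rightarrow> bool"
  where "colocal_module R M \<longleftrightarrow>
    (\<exists>K. submodule K R M \<and> K \<noteq> {\<zero>\<^bsub>M\<^esub>} \<and>
      (\<forall>L. submodule L R M \<and> L \<noteq> {\<zero>\<^bsub>M\<^esub>} \<longrightarrow> K \<subseteq> L))"

definition endo_annihilator ::
    "('a, 'm) ring_scheme \<Rightarrow> ('a, 'b, 'n) module_scheme \<Rightarrow> 'b set \<Rightarrow> ('b \<Rightarrow> 'b) set"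
  where "endo_annihilator R M X = {f \<in> module_endos R M. \<forall>x\<in>X. f x = \<zero>\<^bsub>M\<^esub>}"

(* The intersection of the preimages of Y under all f in An(X). *)
definition internal_coproduct ::
    "('a, 'm) ring_scheme \<Rightarrow> ('a, 'b, 'n) module_scheme \<Rightarrow> 'b set \<Rightarrow> 'b set \<Rightarrow> 'b set"
  where "internal_coproduct R M X Y = {x \<in> carrier M. \<forall>f\<in>endo_annihilator R M X. f x \<in> Y}"

definition fully_coprime ::
    "('a, 'm) ring_scheme \<Rightarrow> ('a, 'b, 'n) module_scheme \<Rightarrow> 'b set \<Rightarrow> bool"
  where "fully_coprime R M K \<longleftrightarrow>
    fully_invariant R M K \<and> K \<noteq> {\<zero>\<^bsub>M\<^esub>} \<and>
    (\<forall>X Y. fully_invariant R M X \<and> fully_invariant R M Y \<and> K \<subseteq> internal_coproduct R M X Y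
      \<longrightarrow> K \<subseteq> X \<or> K \<subseteq> Y)"

definition Spec_fc :: "('a, 'm) ring_scheme \<Rightarrow> ('a, 'b, 'n) module_scheme \<Rightarrow> 'b set set"
  where "Spec_fc R M = {K. fully_coprime R M K}"

definition V_fc :: "('a, 'm) ring_scheme \<Rightarrow> ('a, 'b, 'n) module_scheme \<Rightarrow> 'b set \<Rightarrow> 'b set set"
  where "V_fc R M L = {K \<in> Spec_fc R M. K \<subseteq> L}"

(* Only meaningful for duo modules: then the complements of the sets V_fc R M L do form a topology
   on Spec_fc R M, see istopology_Spec_fc, topspace_Spec_fc and closedin_Spec_fc below. *)
definition Spec_fc_topology ::
    "('a, 'm) ring_scheme \<Rightarrow> ('a, 'b, 'n) module_scheme \<Rightarrow> 'b set topology"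
  where "Spec_fc_topology R M =
    topology (\<lambda>U. \<exists>L. submodule L R M \<and> U = Spec_fc R M - V_fc R M L)"

context left_module
begin

lemma smult_r_null: "a \<in> carrier R \<Longrightarrow> a \<odot>\<^bsub>M\<^esub> \<zero>\<^bsub>M\<^esub> = \<zero>\<^bsub>M\<^esub>"
  using smult_r_distr[of a "\<zero>\<^bsub>M\<^esub>" "\<zero>\<^bsub>M\<^esub>"]
  by (metis M.add.r_cancel_one' M.l_zero M.zero_closed smult_closed)

lemma smult_r_minus:
  assumes "a \<in> carrier R" "x \<in> carrier M"
  shows "a \<odot>\<^bsub>M\<^esub> (\<ominus>\<^bsub>M\<^esub> x) = \<ominus>\<^bsub>M\<^esub> (a \<odot>\<^bsub>M\<^esub> x)"
proof -
  have "a \<odot>\<^bsub>M\<^esub> (\<ominus>\<^bsub>M\<^esub> x) \<oplus>\<^bsub>M\<^esub> a \<odot>\<^bsub>M\<^esub> x = \<zero>\<^bsub>M\<^esub>"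
    using assms smult_r_distr[of a "\<ominus>\<^bsub>M\<^esub> x" x] by (simp add: M.l_neg smult_r_null)
  with assms show ?thesis
    by (metis M.a_inv_closed M.minus_equality smult_closed)
qed

lemma submodule_iff:
  "submodule H R M \<longleftrightarrow> H \<subseteq> carrier M \<and> \<zero>\<^bsub>M\<^esub> \<in> H \<and> (\<forall>x\<in>H. \<ominus>\<^bsub>M\<^esub> x \<in> H) \<and>
    (\<forall>x\<in>H. \<forall>y\<in>H. x \<oplus>\<^bsub>M\<^esub> y \<in> H) \<and> (\<forall>a\<in>carrier R. \<forall>x\<in>H. a \<odot>\<^bsub>M\<^esub> x \<in> H)"
  unfolding submodule_def submodule_axioms_def subgroup_def a_inv_def by auto

lemma submodule_carrier: "submodule (carrier M) R M"
  by (auto simp: submodule_iff)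

lemma submodule_zero: "submodule {\<zero>\<^bsub>M\<^esub>} R M"
  by (auto simp: submodule_iff smult_r_null)

lemma submodule_Inter:
  "\<lbrakk>\<And>L. L \<in> \<L> \<Longrightarrow> submodule L R M\<rbrakk> \<Longrightarrow> submodule (carrier M \<inter> \<Inter>\<L>) R M"
  by (auto simp: submodule_iff)

lemma endo_zero:
  assumes "f \<in> module_endos R M"
  shows "f \<zero>\<^bsub>M\<^esub> = \<zero>\<^bsub>M\<^esub>"
proof -
  have c: "f \<zero>\<^bsub>M\<^esub> \<in> carrier M" and "f (\<zero>\<^bsub>M\<^esub> \<oplus>\<^bsub>M\<^esub> \<zero>\<^bsub>M\<^esub>) = f \<zero>\<^bsub>M\<^esub> \<oplus>\<^bsub>M\<^esub> f \<zero>\<^bsub>M\<^esub>"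
    using assms M.zero_closed unfolding module_homs_def by blast+
  then show ?thesis
    by (metis M.add.r_cancel_one' M.l_zero M.zero_closed)
qed

lemma endo_minus:
  assumes "f \<in> module_endos R M" "x \<in> carrier M"
  shows "f (\<ominus>\<^bsub>M\<^esub> x) = \<ominus>\<^bsub>M\<^esub> f x"
proof -
  have "f (\<ominus>\<^bsub>M\<^esub> x \<oplus>\<^bsub>M\<^esub> x) = f (\<ominus>\<^bsub>M\<^esub> x) \<oplus>\<^bsub>M\<^esub> f x"
    and c: "f x \<in> carrier M" "f (\<ominus>\<^bsub>M\<^esub> x) \<in> carrier M"
    using assms M.a_inv_closed[of x] by (auto simp: module_homs_def)
  then have "f (\<ominus>\<^bsub>M\<^esub> x) \<oplus>\<^bsub>M\<^esub> f x = \<zero>\<^bsub>M\<^esub>"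
    using assms(2) endo_zero[OF assms(1)] by (simp add: M.l_neg)
  with c show ?thesis by (metis M.minus_equality)
qed

lemma submodule_internal_coproduct:
  assumes "submodule Y R M"
  shows "submodule (internal_coproduct R M X Y) R M"
proof -
  have e: "f (x \<oplus>\<^bsub>M\<^esub> y) = f x \<oplus>\<^bsub>M\<^esub> f y" "f (a \<odot>\<^bsub>M\<^esub> x) = a \<odot>\<^bsub>M\<^esub> f x"
      "f (\<ominus>\<^bsub>M\<^esub> x) = \<ominus>\<^bsub>M\<^esub> f x" "f \<zero>\<^bsub>M\<^esub> = \<zero>\<^bsub>M\<^esub>"
    if "f \<in> endo_annihilator R M X" "x \<in> carrier M" "y \<in> carrier M" "a \<in> carrier R" for f x y a
  proof -
    from that have "f \<in> module_endos R M" by (simp add: endo_annihilator_def)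
    with that endo_zero endo_minus show "f (x \<oplus>\<^bsub>M\<^esub> y) = f x \<oplus>\<^bsub>M\<^esub> f y"
        "f (a \<odot>\<^bsub>M\<^esub> x) = a \<odot>\<^bsub>M\<^esub> f x" "f (\<ominus>\<^bsub>M\<^esub> x) = \<ominus>\<^bsub>M\<^esub> f x" "f \<zero>\<^bsub>M\<^esub> = \<zero>\<^bsub>M\<^esub>"
      by (auto simp: module_homs_def)
  qed
  have z: "\<zero>\<^bsub>R\<^esub> \<in> carrier R" "\<zero>\<^bsub>M\<^esub> \<in> carrier M" by simp_all
  show ?thesis
    using assms unfolding submodule_iff internal_coproduct_def
    by (auto simp: e(1)[OF _ _ _ z(1)] e(2)[OF _ _ z(2)] e(3)[OF _ _ z(2) z(1)]
        e(4)[OF _ z(2) z(2) z(1)])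
qed

lemma V_fc_internal_coproduct:
  assumes "fully_invariant R M X" "fully_invariant R M Y"
  shows "V_fc R M (internal_coproduct R M X Y) = V_fc R M X \<union> V_fc R M Y"
proof -
  have "X \<subseteq> carrier M" "Y \<subseteq> carrier M" "\<zero>\<^bsub>M\<^esub> \<in> Y"
    using assms by (auto simp: fully_invariant_def submodule_iff)
  then have "X \<subseteq> internal_coproduct R M X Y" "Y \<subseteq> internal_coproduct R M X Y"
    using assms unfolding internal_coproduct_def endo_annihilator_def fully_invariant_def
    by (auto, blast)
  then show ?thesis
    using assms unfolding V_fc_def Spec_fc_def fully_coprime_def by blast
qed

lemma istopology_Spec_fc:
  assumes "duo_module R M"
  shows "istopology (\<lambda>U. \<exists>L. submodule L R M \<and> U = Spec_fc R M - V_fc R M L)"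
  unfolding istopology_def
proof (intro conjI allI impI)
  fix S T
  assume "\<exists>L. submodule L R M \<and> S = Spec_fc R M - V_fc R M L"
    and "\<exists>L. submodule L R M \<and> T = Spec_fc R M - V_fc R M L"
  then obtain X Y where XY: "submodule X R M" "S = Spec_fc R M - V_fc R M X"
      "submodule Y R M" "T = Spec_fc R M - V_fc R M Y"
    by blast
  then have "S \<inter> T = Spec_fc R M - V_fc R M (internal_coproduct R M X Y)"
    using assms V_fc_internal_coproduct[of X Y] by (auto simp: duo_module_def)
  then show "\<exists>L. submodule L R M \<and> S \<inter> T = Spec_fc R M - V_fc R M L"
    using submodule_internal_coproduct[OF XY(3)] by blast
next
  fix \<K>
  assume "\<forall>U\<in>\<K>. \<exists>L. submodule L R M \<and> U = Spec_fc R M - V_fc R M L"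
  then obtain l where l: "\<And>U. U \<in> \<K> \<Longrightarrow> submodule (l U) R M \<and> U = Spec_fc R M - V_fc R M (l U)"
    by metis
  have c: "K \<subseteq> carrier M" if "K \<in> Spec_fc R M" for K
    using that by (auto simp: Spec_fc_def fully_coprime_def fully_invariant_def submodule_iff)
  have "\<Union>\<K> = (\<Union>U\<in>\<K>. Spec_fc R M - V_fc R M (l U))"
    using l by blast
  also have "\<dots> = Spec_fc R M - V_fc R M (carrier M \<inter> \<Inter>(l ` \<K>))"
    using c by (auto simp: V_fc_def le_INF_iff)
  finally show "\<exists>L. submodule L R M \<and> \<Union>\<K> = Spec_fc R M - V_fc R M L"
    using submodule_Inter[of "l ` \<K>"] l by blast
qed

lemma openin_Spec_fc:
  assumes "duo_module R M"
  shows "openin (Spec_fc_topology R M) U \<longleftrightarrow>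
    (\<exists>L. submodule L R M \<and> U = Spec_fc R M - V_fc R M L)"
  by (simp add: Spec_fc_topology_def topology_inverse'[OF istopology_Spec_fc[OF assms]])

lemma topspace_Spec_fc:
  assumes "duo_module R M"
  shows "topspace (Spec_fc_topology R M) = Spec_fc R M"
proof -
  have "V_fc R M {\<zero>\<^bsub>M\<^esub>} = {}"
    by (auto simp: V_fc_def Spec_fc_def fully_coprime_def fully_invariant_def submodule_iff)
  then have "openin (Spec_fc_topology R M) (Spec_fc R M)"
    using submodule_zero by (metis Diff_empty openin_Spec_fc[OF assms])
  then show ?thesis
    unfolding topspace_def using openin_Spec_fc[OF assms] by blast
qed

lemma closedin_Spec_fc:
  assumes "duo_module R M"
  shows "closedin (Spec_fc_topology R M) C \<longleftrightarrow> (\<exists>L. submodule L R M \<and> C = V_fc R M L)"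
  unfolding closedin_def topspace_Spec_fc[OF assms] openin_Spec_fc[OF assms]
  by (auto simp: V_fc_def)

end

end

theory Submission
  imports Defs
begin

text \<open>
  Write $X \odot Y$ for the internal coproduct of $X$ and $Y$. Two facts make the equivalence work.

  First, self-injectivity makes every fully invariant simple submodule $S$ fully coprime: if
  $S \not\subseteq X$, then $S \cap X = 0$, so the projection $X \oplus S \to S$ extends to an
  endomorphism of $M$ that kills $X$ and fixes $S$ pointwise, and it witnesses that
  $S \subseteq X \odot Y$ forces $S \subseteq Y$. In a self-injective duo module whose fully
  coprime submodules are simple, the points of the spectrum are therefore exactly the simple submodules.

  Second, the spectrum is then discrete. The singleton of a simple submodule $S$ is closed, being
  the set of all points contained in $S$. It is also open: the union $L$ of all submodules that do
  not contain $S$ is again a submodule, because $X$ and $Y$ both lie in $X \odot Y$, which does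
  not contain $S$ if neither $X$ nor $Y$ does. This $L$ contains every simple submodule other
  than $S$, but not $S$ itself.

  A non-empty discrete space is connected exactly when it has a single point. In an atomic module,
  a unique simple submodule is the same as a smallest non-zero submodule.
\<close>

context left_module
begin

section \<open>Simple submodules\<close>

lemma submodule_zero_mem: "submodule L R M \<Longrightarrow> \<zero>\<^bsub>M\<^esub> \<in> L"
  by (simp add: submodule_iff)

lemma submodule_Int:
  "\<lbrakk>submodule K R M; submodule L R M\<rbrakk> \<Longrightarrow> submodule (K \<inter> L) R M"
  by (auto simp: submodule_iff)

text \<open>Simplicity of $S$ quantifies over the submodules of the restricted module, whose additive
  inverse is computed inside $S$; the point is that submodules of $M$ inside $S$ are among them.\<close>

lemma simple_submodule_eq:
  assumes "simple_submodule R M S" "submodule L R M" "L \<subseteq> S" "L \<noteq> {\<zero>\<^bsub>M\<^esub>}"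
  shows "L = S"
proof -
  have S: "subgroup S (add_monoid M)" and L: "subgroup L (add_monoid M)"
    using assms by (auto simp: simple_submodule_def submodule_def)
  then have "subgroup L (add_monoid M\<lparr>carrier := S\<rparr>)"
    using M.a_group group.subgroup_incl assms(3) by blast
  then have "submodule L R (M\<lparr>carrier := S\<rparr>)"
    using assms(2) by (auto simp: submodule_def submodule_axioms_def)
  with assms show ?thesis
    by (auto simp: simple_submodule_def simple_module_def)
qed

lemma simple_submodule_subset_or_Int:
  assumes "simple_submodule R M S" "submodule L R M"
  shows "S \<subseteq> L \<or> L \<inter> S = {\<zero>\<^bsub>M\<^esub>}"
proof -
  have "submodule (L \<inter> S) R M"
    using assms by (intro submodule_Int) (auto simp: simple_submodule_def)
  then show ?thesis
    using simple_submodule_eq[OF assms(1), of "L \<inter> S"] by blast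
qed

lemma simple_submodule_nonzero: "simple_submodule R M S \<Longrightarrow> S \<noteq> {\<zero>\<^bsub>M\<^esub>}"
  by (simp add: simple_submodule_def simple_module_def)

section \<open>Self-injectivity and full coprimeness of simple submodules\<close>

lemma add_interchange:
  assumes "a \<in> carrier M" "b \<in> carrier M" "c \<in> carrier M" "d \<in> carrier M"
  shows "(a \<oplus>\<^bsub>M\<^esub> b) \<oplus>\<^bsub>M\<^esub> (c \<oplus>\<^bsub>M\<^esub> d) = (a \<oplus>\<^bsub>M\<^esub> c) \<oplus>\<^bsub>M\<^esub> (b \<oplus>\<^bsub>M\<^esub> d)"
  using assms by (simp add: M.a_ac)

lemma independent_sum_unique:
  assumes X: "submodule X R M" and S: "submodule S R M" and XS: "X \<inter> S = {\<zero>\<^bsub>M\<^esub>}"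
    and mem: "x \<in> X" "x' \<in> X" "s \<in> S" "s' \<in> S"
    and eq: "x \<oplus>\<^bsub>M\<^esub> s = x' \<oplus>\<^bsub>M\<^esub> s'"
  shows "s = s'"
proof -
  have c: "x \<in> carrier M" "x' \<in> carrier M" "s \<in> carrier M" "s' \<in> carrier M"
    using X S mem by (auto simp: submodule_iff)
  have "s \<oplus>\<^bsub>M\<^esub> \<ominus>\<^bsub>M\<^esub> s' = (\<ominus>\<^bsub>M\<^esub> x \<oplus>\<^bsub>M\<^esub> (x \<oplus>\<^bsub>M\<^esub> s)) \<oplus>\<^bsub>M\<^esub> \<ominus>\<^bsub>M\<^esub> s'"
    using c by (simp add: M.r_neg1)
  also have "\<dots> = \<ominus>\<^bsub>M\<^esub> x \<oplus>\<^bsub>M\<^esub> x'"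
    using c by (simp add: eq M.a_assoc M.r_neg)
  finally have d: "s \<oplus>\<^bsub>M\<^esub> \<ominus>\<^bsub>M\<^esub> s' = \<ominus>\<^bsub>M\<^esub> x \<oplus>\<^bsub>M\<^esub> x'" .
  have "s \<oplus>\<^bsub>M\<^esub> \<ominus>\<^bsub>M\<^esub> s' \<in> S" "\<ominus>\<^bsub>M\<^esub> x \<oplus>\<^bsub>M\<^esub> x' \<in> X"
    using X S mem by (auto simp: submodule_iff)
  then have "s \<oplus>\<^bsub>M\<^esub> \<ominus>\<^bsub>M\<^esub> s' = \<zero>\<^bsub>M\<^esub>"
    using d XS by auto
  then show ?thesis
    using c by (metis M.a_inv_closed M.minus_equality M.minus_minus)
qed

text \<open>Self-injectivity is applied to the projection of the internal direct sum of $X$ and $S$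
  onto its second summand.\<close>

lemma self_injective_projection:
  assumes inj: "self_injective R M"
    and X: "submodule X R M" and S: "submodule S R M" and XS: "X \<inter> S = {\<zero>\<^bsub>M\<^esub>}"
  obtains h where "h \<in> module_endos R M" "\<And>x. x \<in> X \<Longrightarrow> h x = \<zero>\<^bsub>M\<^esub>" "\<And>s. s \<in> S \<Longrightarrow> h s = s"
proof -
  define N where "N = {x \<oplus>\<^bsub>M\<^esub> s | x s. x \<in> X \<and> s \<in> S}"
  define g where "g z = (THE s. s \<in> S \<and> (\<exists>x\<in>X. z = x \<oplus>\<^bsub>M\<^esub> s))" for z
  have X': "\<And>x. x \<in> X \<Longrightarrow> x \<in> carrier M" "\<And>x. x \<in> X \<Longrightarrow> \<ominus>\<^bsub>M\<^esub> x \<in> X"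
    "\<And>x y. x \<in> X \<Longrightarrow> y \<in> X \<Longrightarrow> x \<oplus>\<^bsub>M\<^esub> y \<in> X"
    "\<And>a x. a \<in> carrier R \<Longrightarrow> x \<in> X \<Longrightarrow> a \<odot>\<^bsub>M\<^esub> x \<in> X"
    using X by (auto simp: submodule_iff)
  have S': "\<And>x. x \<in> S \<Longrightarrow> x \<in> carrier M" "\<And>x. x \<in> S \<Longrightarrow> \<ominus>\<^bsub>M\<^esub> x \<in> S"
    "\<And>x y. x \<in> S \<Longrightarrow> y \<in> S \<Longrightarrow> x \<oplus>\<^bsub>M\<^esub> y \<in> S"
    "\<And>a x. a \<in> carrier R \<Longrightarrow> x \<in> S \<Longrightarrow> a \<odot>\<^bsub>M\<^esub> x \<in> S"
    using S by (auto simp: submodule_iff)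
  have g: "g (x \<oplus>\<^bsub>M\<^esub> s) = s" if "x \<in> X" "s \<in> S" for x s
    unfolding g_def using that independent_sum_unique[OF X S XS] by (intro the_equality) blast+
  have add: "(x \<oplus>\<^bsub>M\<^esub> s) \<oplus>\<^bsub>M\<^esub> (x' \<oplus>\<^bsub>M\<^esub> s') = (x \<oplus>\<^bsub>M\<^esub> x') \<oplus>\<^bsub>M\<^esub> (s \<oplus>\<^bsub>M\<^esub> s')"
    if "x \<in> X" "x' \<in> X" "s \<in> S" "s' \<in> S" for x x' s s'
    by (rule add_interchange; simp add: that X'(1) S'(1))
  have smult: "a \<odot>\<^bsub>M\<^esub> (x \<oplus>\<^bsub>M\<^esub> s) = a \<odot>\<^bsub>M\<^esub> x \<oplus>\<^bsub>M\<^esub> a \<odot>\<^bsub>M\<^esub> s"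
    if "a \<in> carrier R" "x \<in> X" "s \<in> S" for a x s
    by (rule smult_r_distr; simp add: that X'(1) S'(1))
  have g_add: "g ((x \<oplus>\<^bsub>M\<^esub> s) \<oplus>\<^bsub>M\<^esub> (x' \<oplus>\<^bsub>M\<^esub> s')) = s \<oplus>\<^bsub>M\<^esub> s'"
    if "x \<in> X" "x' \<in> X" "s \<in> S" "s' \<in> S" for x x' s s'
    unfolding add[OF that] using that by (intro g X'(3) S'(3))
  have minus: "\<ominus>\<^bsub>M\<^esub> (x \<oplus>\<^bsub>M\<^esub> s) = \<ominus>\<^bsub>M\<^esub> x \<oplus>\<^bsub>M\<^esub> \<ominus>\<^bsub>M\<^esub> s" if "x \<in> X" "s \<in> S" for x s
    by (rule M.minus_add; simp add: that X'(1) S'(1))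
  have zero: "\<zero>\<^bsub>M\<^esub> \<in> X" "\<zero>\<^bsub>M\<^esub> \<in> S"
    using X S by (auto intro: submodule_zero_mem)
  have N_memI: "x \<oplus>\<^bsub>M\<^esub> s \<in> N" if "x \<in> X" "s \<in> S" for x s
    using that unfolding N_def by blast
  have N_memE: "\<exists>x\<in>X. \<exists>s\<in>S. z = x \<oplus>\<^bsub>M\<^esub> s" if "z \<in> N" for z
    using that unfolding N_def by blast
  have N: "submodule N R M"
    unfolding submodule_iff
  proof (intro conjI ballI)
    show "N \<subseteq> carrier M" by (auto simp: N_def X'(1) S'(1))
    show "\<zero>\<^bsub>M\<^esub> \<in> N" using N_memI[OF zero] by simp
  next
    fix z assume "z \<in> N"
    then show "\<ominus>\<^bsub>M\<^esub> z \<in> N" by (auto dest!: N_memE simp: minus X'(2) S'(2) N_memI)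
  next
    fix z w assume "z \<in> N" "w \<in> N"
    then show "z \<oplus>\<^bsub>M\<^esub> w \<in> N" by (auto dest!: N_memE simp: add X'(3) S'(3) N_memI)
  next
    fix a z assume "a \<in> carrier R" "z \<in> N"
    then show "a \<odot>\<^bsub>M\<^esub> z \<in> N" by (auto dest!: N_memE simp: smult X'(4) S'(4) N_memI)
  qed
  have "g \<in> module_homs R (M\<lparr>carrier := N\<rparr>) M"
    unfolding module_homs_def by (auto dest!: N_memE simp: g g_add smult X' S')
  then obtain h where h: "h \<in> module_endos R M" "\<And>z. z \<in> N \<Longrightarrow> h z = g z"
    using inj N unfolding self_injective_def by blast
  have "h x = \<zero>\<^bsub>M\<^esub>" if "x \<in> X" for x
    using h(2)[of "x \<oplus>\<^bsub>M\<^esub> \<zero>\<^bsub>M\<^esub>"] g[of x "\<zero>\<^bsub>M\<^esub>"] N_memI[of x "\<zero>\<^bsub>M\<^esub>"] that zero X'(1)[of x] by simp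
  moreover have "h s = s" if "s \<in> S" for s
    using h(2)[of "\<zero>\<^bsub>M\<^esub> \<oplus>\<^bsub>M\<^esub> s"] g[of "\<zero>\<^bsub>M\<^esub>" s] N_memI[of "\<zero>\<^bsub>M\<^esub>" s] that zero S'(1)[of s] by simp
  ultimately show thesis using that h(1) by blast
qed

text \<open>If $S \not\subseteq X$, the endomorphism that kills $X$ and fixes $S$ is one of those
  defining $X \odot Y$, so $S \subseteq X \odot Y$ gives $S \subseteq Y$.\<close>

lemma simple_imp_fully_coprime:
  assumes "self_injective R M" "fully_invariant R M S" "simple_submodule R M S"
  shows "fully_coprime R M S"
  unfolding fully_coprime_def
proof (intro conjI allI impI)
  show "fully_invariant R M S" "S \<noteq> {\<zero>\<^bsub>M\<^esub>}"
    using assms simple_submodule_nonzero by auto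
  fix X Y
  assume *: "fully_invariant R M X \<and> fully_invariant R M Y \<and> S \<subseteq> internal_coproduct R M X Y"
  then have sub: "submodule X R M" "submodule S R M"
    using assms by (auto simp: fully_invariant_def)
  show "S \<subseteq> X \<or> S \<subseteq> Y"
  proof (rule disjCI)
    assume "\<not> S \<subseteq> Y"
    show "S \<subseteq> X"
    proof (rule ccontr)
      assume "\<not> S \<subseteq> X"
      then have "X \<inter> S = {\<zero>\<^bsub>M\<^esub>}"
        using simple_submodule_subset_or_Int[OF assms(3) sub(1)] by blast
      then obtain h where "h \<in> module_endos R M" "\<And>x. x \<in> X \<Longrightarrow> h x = \<zero>\<^bsub>M\<^esub>" "\<And>s. s \<in> S \<Longrightarrow> h s = s"
        using self_injective_projection[OF assms(1) sub] by blast
      then have "S \<subseteq> Y"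
        using * by (force simp: internal_coproduct_def endo_annihilator_def)
      with \<open>\<not> S \<subseteq> Y\<close> show False ..
    qed
  qed
qed

section \<open>Discreteness of the spectrum\<close>

lemma subset_internal_coproduct:
  assumes "fully_invariant R M X" "fully_invariant R M Y"
  shows "X \<subseteq> internal_coproduct R M X Y" "Y \<subseteq> internal_coproduct R M X Y"
proof -
  have "X \<subseteq> carrier M" "Y \<subseteq> carrier M" "\<zero>\<^bsub>M\<^esub> \<in> Y"
    using assms by (auto simp: fully_invariant_def submodule_iff)
  then show "X \<subseteq> internal_coproduct R M X Y" "Y \<subseteq> internal_coproduct R M X Y"
    using assms unfolding internal_coproduct_def endo_annihilator_def fully_invariant_def
    by (auto, blast)
qed

text \<open>In a duo module, full coprimeness of $K$ makes the submodules not containing $K$ a directed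
  family: an upper bound of $X$ and $Y$ is $X \odot Y$. Hence their union is a submodule.\<close>

lemma submodule_Union_not_containing:
  assumes duo: "duo_module R M" and K: "fully_coprime R M K"
  shows "submodule (\<Union>{X. submodule X R M \<and> \<not> K \<subseteq> X}) R M" (is "submodule ?L R M")
proof (rule submodule_iff[THEN iffD2], intro conjI ballI)
  show "?L \<subseteq> carrier M" by (auto simp: submodule_iff)
  have "\<zero>\<^bsub>M\<^esub> \<in> K" "K \<noteq> {\<zero>\<^bsub>M\<^esub>}"
    using K by (auto simp: fully_coprime_def fully_invariant_def submodule_iff)
  then have "\<not> K \<subseteq> {\<zero>\<^bsub>M\<^esub>}" by blast
  then show "\<zero>\<^bsub>M\<^esub> \<in> ?L" using submodule_zero by blast
next
  fix x assume "x \<in> ?L"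
  then obtain X where X: "submodule X R M" "\<not> K \<subseteq> X" "x \<in> X" by blast
  then have "\<ominus>\<^bsub>M\<^esub> x \<in> X" by (simp add: submodule_iff)
  with X show "\<ominus>\<^bsub>M\<^esub> x \<in> ?L" by blast
next
  fix a x assume a: "a \<in> carrier R" and "x \<in> ?L"
  then obtain X where X: "submodule X R M" "\<not> K \<subseteq> X" "x \<in> X" by blast
  then have "a \<odot>\<^bsub>M\<^esub> x \<in> X" using a by (simp add: submodule_iff)
  with X show "a \<odot>\<^bsub>M\<^esub> x \<in> ?L" by blast
next
  fix x y assume "x \<in> ?L" "y \<in> ?L"
  then obtain X Y where X: "submodule X R M" "\<not> K \<subseteq> X" "x \<in> X"
    and Y: "submodule Y R M" "\<not> K \<subseteq> Y" "y \<in> Y"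
    by blast
  define Z where "Z = internal_coproduct R M X Y"
  have inv: "fully_invariant R M X" "fully_invariant R M Y"
    using duo X Y by (auto simp: duo_module_def)
  then have "\<not> K \<subseteq> Z"
    using K X Y unfolding fully_coprime_def Z_def by blast
  moreover have Z: "submodule Z R M"
    unfolding Z_def by (rule submodule_internal_coproduct[OF Y(1)])
  moreover have "x \<oplus>\<^bsub>M\<^esub> y \<in> Z"
  proof -
    have "x \<in> Z" "y \<in> Z"
      using subset_internal_coproduct[OF inv] X(3) Y(3) by (auto simp: Z_def)
    then show ?thesis using Z by (simp add: submodule_iff)
  qed
  ultimately show "x \<oplus>\<^bsub>M\<^esub> y \<in> ?L" by blast
qed

text \<open>The union of the submodules not containing $S$ meets $S$ only in zero, since a submodule
  containing a non-zero element of $S$ contains $S$. So the points inside that union are exactly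
  the points that do not contain $S$.\<close>

lemma V_fc_Union_not_containing_simple:
  assumes S: "simple_submodule R M S"
  shows "V_fc R M (\<Union>{X. submodule X R M \<and> \<not> S \<subseteq> X}) = {K \<in> Spec_fc R M. \<not> S \<subseteq> K}"
    (is "V_fc R M ?L = ?C")
proof -
  have "?L \<inter> S \<subseteq> {\<zero>\<^bsub>M\<^esub>}"
    using simple_submodule_subset_or_Int[OF S] by blast
  moreover have "\<zero>\<^bsub>M\<^esub> \<in> S" "S \<noteq> {\<zero>\<^bsub>M\<^esub>}"
    using S simple_submodule_nonzero submodule_zero_mem by (auto simp: simple_submodule_def)
  ultimately have "\<not> S \<subseteq> ?L" by blast
  moreover have "submodule K R M" if "K \<in> Spec_fc R M" for K
    using that by (auto simp: Spec_fc_def fully_coprime_def fully_invariant_def)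
  ultimately show ?thesis unfolding V_fc_def by blast
qed

lemma simple_point_clopen:
  assumes duo: "duo_module R M"
    and simple: "\<And>K. K \<in> Spec_fc R M \<Longrightarrow> simple_submodule R M K"
    and S: "S \<in> Spec_fc R M"
  shows "openin (Spec_fc_topology R M) {S}" "closedin (Spec_fc_topology R M) {S}"
proof -
  have eq: "K = L" if "K \<in> Spec_fc R M" "L \<in> Spec_fc R M" "K \<subseteq> L" for K L
    using that simple[of K] simple[of L] simple_submodule_eq simple_submodule_nonzero
    by (auto simp: simple_submodule_def)
  have "V_fc R M S = {S}"
    using S eq by (auto simp: V_fc_def)
  then show "closedin (Spec_fc_topology R M) {S}"
    unfolding closedin_Spec_fc[OF duo] using simple[OF S] by (auto simp: simple_submodule_def)
  let ?L = "\<Union>{X. submodule X R M \<and> \<not> S \<subseteq> X}"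
  have "{S} = Spec_fc R M - V_fc R M ?L"
    unfolding V_fc_Union_not_containing_simple[OF simple[OF S]] using S eq by blast
  moreover have "submodule ?L R M"
    using submodule_Union_not_containing[OF duo] S by (simp add: Spec_fc_def)
  ultimately show "openin (Spec_fc_topology R M) {S}"
    unfolding openin_Spec_fc[OF duo] by blast
qed

section \<open>Colocal modules and connectedness\<close>

lemma atomic_colocal_iff_unique_simple:
  assumes atomic: "atomic_module R M"
  shows "colocal_module R M \<longleftrightarrow> (\<exists>S. {K. simple_submodule R M K} = {S})"
proof
  assume "colocal_module R M"
  then obtain K where K: "submodule K R M" "K \<noteq> {\<zero>\<^bsub>M\<^esub>}"
    and least: "\<And>L. submodule L R M \<Longrightarrow> L \<noteq> {\<zero>\<^bsub>M\<^esub>} \<Longrightarrow> K \<subseteq> L"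
    unfolding colocal_module_def by blast
  have "S = K" if "simple_submodule R M S" for S
    using that least[of S] K simple_submodule_eq[OF that, of K] simple_submodule_nonzero[OF that]
    by (auto simp: simple_submodule_def)
  moreover have "\<exists>S. simple_submodule R M S"
    using atomic K unfolding atomic_module_def by blast
  ultimately show "\<exists>S. {K. simple_submodule R M K} = {S}" by blast
next
  assume "\<exists>S. {K. simple_submodule R M K} = {S}"
  then obtain S where S: "\<And>K. simple_submodule R M K \<longleftrightarrow> K = S" by blast
  have "submodule S R M" "S \<noteq> {\<zero>\<^bsub>M\<^esub>}"
    using S[of S] simple_submodule_nonzero by (auto simp: simple_submodule_def)
  moreover have "S \<subseteq> L" if "submodule L R M" "L \<noteq> {\<zero>\<^bsub>M\<^esub>}" for L
    using that atomic S unfolding atomic_module_def by blast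
  ultimately show "colocal_module R M" unfolding colocal_module_def by blast
qed

end

theorem theorem3p34:
  fixes R :: "('a, 'm) ring_scheme" and M :: "('a, 'b, 'n) module_scheme"
  assumes "left_module R M"
    and "\<one>\<^bsub>R\<^esub> \<noteq> \<zero>\<^bsub>R\<^esub>"
    and "carrier M \<noteq> {\<zero>\<^bsub>M\<^esub>}"
    and "S_IAD_module R M"
    and "\<And>K. fully_coprime R M K \<Longrightarrow> simple_submodule R M K"
  shows "colocal_module R M \<longleftrightarrow>
    topspace (Spec_fc_topology R M) \<noteq> {} \<and> connected_space (Spec_fc_topology R M)"
proof -
  interpret left_module R M by fact
  let ?T = "Spec_fc_topology R M"
  have inj: "self_injective R M" and atomic: "atomic_module R M" and duo: "duo_module R M"
    using assms(4) by (auto simp: S_IAD_module_def)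
  have "fully_coprime R M K \<longleftrightarrow> simple_submodule R M K" for K
  proof
    assume "simple_submodule R M K"
    moreover from this have "fully_invariant R M K"
      using duo by (simp add: duo_module_def simple_submodule_def)
    ultimately show "fully_coprime R M K"
      by (intro simple_imp_fully_coprime[OF inj])
  qed (rule assms(5))
  then have Spec: "Spec_fc R M = {K. simple_submodule R M K}"
    by (simp add: Spec_fc_def)
  have colocal: "colocal_module R M \<longleftrightarrow> (\<exists>S. topspace ?T = {S})"
    unfolding topspace_Spec_fc[OF duo] Spec
    by (rule atomic_colocal_iff_unique_simple[OF atomic])
  have clopen: "openin ?T {S}" "closedin ?T {S}" if "S \<in> topspace ?T" for S
    using simple_point_clopen[OF duo, of S] that by (simp_all add: topspace_Spec_fc[OF duo] Spec)
  show ?thesis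
  proof
    assume "colocal_module R M"
    then obtain S where S: "topspace ?T = {S}"
      using colocal by blast
    then have "connected_space ?T"
      unfolding connected_space_clopen_in using openin_subset by fastforce
    with S show "topspace ?T \<noteq> {} \<and> connected_space ?T" by simp
  next
    assume conn: "topspace ?T \<noteq> {} \<and> connected_space ?T"
    then obtain S where "S \<in> topspace ?T" by blast
    then have "topspace ?T = {S}"
      using clopen conn unfolding connected_space_clopen_in by blast
    then show "colocal_module R M"
      using colocal by blast
  qed
qed

end
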